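(* Let $f$ be an instance of (weighted) $\mathrm{MAXCSP}$ with $n$ Boolean variables, total weight $w$ and weighted length $\ell$. For any $\varepsilon\in(0,1]$, $$\mathcal{D}(f,\varepsilon)=\Omega^\ast\left(\max_{\delta\ge 1+\frac{\varepsilon w}{\ell}}\left\{2^{H\left(\frac{\varepsilon w}{(\delta-1)\ell}\right)\frac{\delta-1}{\delta}n}\right\}\right),$$ where the maximum is over real numbers $\delta\ge 1+\frac{\varepsilon w}{\ell}$, $\mathcal{D}(f,\varepsilon)$ is the number of assignments $z\in\{0,1\}^n$ with $\mathcal{W}(f,z)\ge w^\ast-\varepsilon w$, and $H$ is the binary entropy function.
   Context: An instance $f$ of (weighted) $\mathrm{MAXCSP}$ consists of $n\ge 1$ Boolean variables $x_1,\dots,x_n$ and $m\ge 1$ constraints $C_1,\dots,C_m$. Each constraint $C_i$ is an arbitrary Boolean predicate on some set of $a_i\ge 1$ distinct variables among $x_1,\dots,x_n$, and has a weight $w_i$, a positive real number. The total weight is $w=\sum_{i=1}^m w_i$ and the weighted length is $\ell=\sum_{i=1}^m a_iw_i$. For $z\in\{0,1\}^n$, $\mathcal{W}(f,z)$ is the sum of the weights of all constraints of $f$ satisfied by $z$, and $w^\ast=\max_{z\in\{0,1\}^n}\mathcal{W}(f,z)$. For $\varepsilon\in(0,1]$, $\mathcal{D}(f,\varepsilon)$ is the number of assignments $z\in\{0,1\}^n$ such that $\mathcal{W}(f,z)\ge w^\ast-\varepsilon w$ (the subtracted term is $\varepsilon$ times the total weight $w$, not $\varepsilon w^\ast$). The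 binary entropy function is $H(p)=-p\log_2 p-(1-p)\log_2(1-p)$ for $p\in[0,1]$, with the convention $0\log_2 0=0$. The notation $\Omega^\ast(\cdot)$ removes $\mathrm{poly}(n)$ factors: $A=\Omega^\ast(B)$ means that there is a fixed polynomial $p$, positive on positive integers and independent of $f$ and $\varepsilon$, such that $A\ge B/p(n)$ for all instances. *)

theory Defs
  imports "HOL-Library.FuncSet" "HOL-Computational_Algebra.Polynomial" Complex_Main
begin

text \<open>The predicate of a constraint is only ever applied to assignments that are restricted
  to the variable set of the constraint (see \<open>satisfied\<close>), so it amounts to an arbitrary
  Boolean predicate on that set of variables.\<close>

record csp_constraint =
  vars :: "nat set"
  predicate :: "(nat \<Rightarrow> bool) \<Rightarrow> bool"
  weight :: real

text \<open>The variables of an instance are indexed by \<open>{1..num_vars f}\<close>. Constraints form a list,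
  so that the same constraint may occur repeatedly.\<close>

record maxcsp =
  num_vars :: nat
  constraints :: "csp_constraint list"

definition maxcsp_instance :: "maxcsp \<Rightarrow> bool" where
  "maxcsp_instance f \<longleftrightarrow>
     num_vars f \<ge> 1 \<and> constraints f \<noteq> [] \<and>
     (\<forall>C \<in> set (constraints f).
        vars C \<subseteq> {1..num_vars f} \<and> vars C \<noteq> {} \<and> weight C > 0)"

definition assignments :: "maxcsp \<Rightarrow> (nat \<Rightarrow> bool) set" where
  "assignments f = {1..num_vars f} \<rightarrow>\<^sub>E UNIV"

definition satisfied :: "(nat \<Rightarrow> bool) \<Rightarrow> csp_constraint \<Rightarrow> bool" where
  "satisfied z C \<longleftrightarrow> predicate C (restrict z (vars C))"

definition total_weight :: "maxcsp \<Rightarrow> real" where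
  "total_weight f = (\<Sum>C\<leftarrow>constraints f. weight C)"

definition weighted_length :: "maxcsp \<Rightarrow> real" where
  "weighted_length f = (\<Sum>C\<leftarrow>constraints f. real (card (vars C)) * weight C)"

definition sat_weight :: "maxcsp \<Rightarrow> (nat \<Rightarrow> bool) \<Rightarrow> real" where
  "sat_weight f z = (\<Sum>C\<leftarrow>filter (satisfied z) (constraints f). weight C)"

definition opt_weight :: "maxcsp \<Rightarrow> real" where
  "opt_weight f = Max (sat_weight f ` assignments f)"

definition num_approx :: "maxcsp \<Rightarrow> real \<Rightarrow> nat" where
  "num_approx f \<epsilon> =
     card {z \<in> assignments f. sat_weight f z \<ge> opt_weight f - \<epsilon> * total_weight f}"

text \<open>The convention for \<open>p = 0\<close> and \<open>p = 1\<close> holds automatically, because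
  \<open>0 * log 2 0 = 0\<close>.\<close>

definition binary_entropy :: "real \<Rightarrow> real" where
  "binary_entropy p = - p * log 2 p - (1 - p) * log 2 (1 - p)"

end

theory Submission
  imports Defs
begin

text \<open>Starting from an optimal assignment, flipping a set of variables costs at most their total
  load, the load of a variable being the weight of the constraints containing it. The loads add up
  to \<open>\<ell>\<close>, so by Markov's inequality at least \<open>(\<delta> - 1) n / \<delta>\<close> variables have load at most
  \<open>\<delta> \<ell> / n\<close>, and any \<open>\<epsilon> w n / (\<delta> \<ell>)\<close> of them may be flipped. The resulting binomial coefficient
  is compared with the entropy bound by Gibbs' inequality.

  In terms of \<open>c = \<epsilon> w / \<ell>\<close> and \<open>p = c / (\<delta> - 1) \<in> (0, 1]\<close> the exponent is \<open>H(p) c n / (p + c)\<close>.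
  This extends continuously by \<open>0\<close> to \<open>p = 0\<close>, so the maximum is attained.\<close>

section \<open>Binary entropy\<close>

lemma binary_entropy_0 [simp]: "binary_entropy 0 = 0"
  and binary_entropy_1 [simp]: "binary_entropy 1 = 0"
  by (simp_all add: binary_entropy_def)

lemma binary_entropy_half: "binary_entropy (1 / 2) = 1"
  by (simp add: binary_entropy_def log_divide)

text \<open>Only \<open>x = 0\<close> needs an argument: there \<open>x * ln x\<close> is squeezed
  to 0 by \<open>2 * sqrt \<bar>x\<bar>\<close>.\<close>

lemma isCont_x_log_x: "isCont (\<lambda>x::real. x * log 2 x) x"
proof (cases "x = 0")
  case True
  have "((\<lambda>x::real. x * ln x) \<longlongrightarrow> 0) (at 0)"
  proof (rule tendsto_0_le)
    show "\<forall>\<^sub>F x::real in at 0. norm (x * ln x) \<le> norm (sqrt \<bar>x\<bar>) * 2"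
    proof -
      have pos: "\<bar>x * ln x\<bar> \<le> 2 * sqrt \<bar>x\<bar>" if "0 < x" "x < 1" for x :: real
      proof -
        have "- ln x = 2 * ln (1 / sqrt x)" using that by (simp add: ln_div ln_sqrt)
        \<comment> \<open>From \<open>ln y \<le> y - 1\<close> at \<open>y = 1 / sqrt x\<close>;
          passing to the root first is what leaves a positive power of \<open>x\<close> after
          multiplying by \<open>x\<close>.\<close>
        also have "\<dots> \<le> 2 * (1 / sqrt x)"
          using that ln_le_minus_one[of "1 / sqrt x"] by simp
        finally have "x * - ln x \<le> x * (2 * (1 / sqrt x))"
          using that by (intro mult_left_mono) auto
        also have "\<dots> = 2 * sqrt x"
          using that real_div_sqrt[of x] by (simp add: field_simps)
        finally show ?thesis using that by (simp add: abs_mult)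
      qed
      \<comment> \<open>The limit is two-sided. Negative \<open>x\<close> reduce to positive ones
        because \<open>ln\<close> takes the same value at \<open>x\<close> and
        \<open>- x\<close>.\<close>
      have "\<bar>x * ln x\<bar> \<le> 2 * sqrt \<bar>x\<bar>" if "\<bar>x\<bar> < 1" "x \<noteq> 0" for x :: real
        using pos[of x] pos[of "- x"] that by (cases "x > 0") (auto simp: ln_minus)
      then show ?thesis
        unfolding eventually_at by (intro exI[of _ 1]) (auto simp: dist_real_def mult.commute)
    qed
    show "((\<lambda>x::real. sqrt \<bar>x\<bar>) \<longlongrightarrow> 0) (at 0)"
      by (auto intro!: tendsto_eq_intros)
  qed
  then have "((\<lambda>x::real. x * ln x / ln 2) \<longlongrightarrow> 0 / ln 2) (at 0)"
    by (intro tendsto_intros) auto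
  with True show ?thesis
    by (simp add: isCont_def log_def)
qed (auto intro!: continuous_intros)

lemma continuous_on_binary_entropy: "continuous_on A binary_entropy"
proof -
  have "isCont binary_entropy x" for x
  proof -
    have "isCont (\<lambda>p. - (p * log 2 p) - (\<lambda>x. x * log 2 x) (1 - p)) x"
      by (intro continuous_intros isCont_x_log_x isCont_o2[OF _ isCont_x_log_x])
    then show ?thesis
      by (simp add: binary_entropy_def[abs_def])
  qed
  then show ?thesis
    by (simp add: continuous_at_imp_continuous_on)
qed

text \<open>The pointwise bound \<open>x * ln y - x * ln x \<le> y - x\<close> is applied to
  \<open>p, q\<close> and to \<open>1 - p, 1 - q\<close>; the two right-hand sides cancel.\<close>

lemma gibbs_binary:
  assumes "0 \<le> p" "p \<le> 1" "0 < q" "q < 1"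
  shows "binary_entropy p \<le> - p * log 2 q - (1 - p) * log 2 (1 - q)"
proof -
  have *: "x * ln y - x * ln x \<le> y - x" if "0 \<le> x" "0 < y" for x y :: real
  proof (cases "x = 0")
    case False
    with that have "ln (y / x) \<le> y / x - 1"
      by (intro ln_le_minus_one) auto
    with False that have "x * (ln y - ln x) \<le> x * (y / x - 1)"
      by (intro mult_left_mono) (auto simp: ln_div)
    with False show ?thesis
      by (simp add: algebra_simps)
  qed (use that in auto)
  have "p * ln q + (1 - p) * ln (1 - q) \<le> p * ln p + (1 - p) * ln (1 - p)"
    using *[of p q] *[of "1 - p" "1 - q"] assms by linarith
  then have "(p * ln q + (1 - p) * ln (1 - q)) / ln 2 \<le> (p * ln p + (1 - p) * ln (1 - p)) / ln 2"
    by (intro divide_right_mono) auto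
  then show ?thesis
    by (simp add: binary_entropy_def log_def add_divide_distrib)
qed

text \<open>Gibbs' inequality in exponential form. The free parameter \<open>q\<close> is later
  matched to the binomial coefficient to be bounded, and \<open>N\<close> need not be an
  integer.\<close>

lemma powr_entropy_le:
  assumes "0 \<le> p" "p \<le> 1" "0 < q" "q < 1" "0 \<le> N"
  shows "2 powr (binary_entropy p * N) \<le> q powr (- (p * N)) * (1 - q) powr (- ((1 - p) * N))"
proof -
  have "2 powr (binary_entropy p * N) \<le> 2 powr ((- p * log 2 q - (1 - p) * log 2 (1 - q)) * N)"
    using gibbs_binary[of p q] assms by (auto intro!: powr_mono mult_right_mono)
  also have "\<dots> = (2 powr log 2 q) powr (- (p * N)) * (2 powr log 2 (1 - q)) powr (- ((1 - p) * N))"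
    unfolding powr_powr powr_add[symmetric] by (simp add: algebra_simps)
  finally show ?thesis
    using assms by simp
qed

section \<open>Binomial coefficients against entropy\<close>

text \<open>These are the terms in the expansion of \<open>(k + (m - k)) ^ m\<close>. The ratio of
  term \<open>j + 1\<close> to term \<open>j\<close> is \<open>(m - j) * k\<close> over
  \<open>(j + 1) * (m - k)\<close>, which is at least 1 for \<open>j < k\<close> and at most 1 for
  \<open>j \<ge> k\<close>, so the terms peak at \<open>j = k\<close>.\<close>

lemma binomial_term_le_mode:
  fixes m k j :: nat
  assumes "k \<le> m" "j \<le> m"
  shows "(m choose j) * k ^ j * (m - k) ^ (m - j) \<le> (m choose k) * k ^ k * (m - k) ^ (m - k)"
proof -
  define t where "t j = (m choose j) * k ^ j * (m - k) ^ (m - j)" for j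
  have ratio: "t (Suc j) * (Suc j * (m - k)) = t j * ((m - j) * k)" if "j < m" for j
  proof -
    have e: "m - j = Suc (m - Suc j)" using that by simp
    have b: "Suc j * (m choose Suc j) = (m - j) * (m choose j)"
      by (simp only: binomial_absorb_comp binomial_absorption)
    have "t (Suc j) * (Suc j * (m - k))
        = (Suc j * (m choose Suc j)) * (k ^ Suc j * (m - k) ^ Suc (m - Suc j))"
      by (simp add: t_def algebra_simps)
    also have "\<dots> = t j * ((m - j) * k)"
      unfolding b t_def using e by (simp add: algebra_simps)
    finally show ?thesis .
  qed
  have "t j \<le> t k"
  \<comment> \<open>At the extremes a factor of \<open>ratio\<close> vanishes and cannot be
    cancelled, but then every term with \<open>j \<noteq> k\<close> is 0.\<close>
  proof (cases "k = 0 \<or> k = m")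
    case True
    then show ?thesis using assms by (cases "j = k") (auto simp: t_def power_0_left)
  next
    case False
    with assms have k: "0 < k" "k < m" by auto
    show ?thesis
    proof (cases "j \<le> k")
      case True
      then show ?thesis
      proof (induction rule: inc_induct)
        case (step i)
        have "Suc i * (m - k) \<le> k * (m - i)"
          using step by (intro mult_le_mono) auto
        moreover have "i < m" using step k by simp
        ultimately have "t i * ((m - i) * k) \<le> t (Suc i) * ((m - i) * k)"
          unfolding ratio[OF \<open>i < m\<close>, symmetric] by (intro mult_le_mono2) (simp only: mult.commute)
        then show ?case
          using step k by simp
      qed simp
    next
      case False
      then have "k \<le> j" by simp
      then show ?thesis
        using assms(2)
      proof (induction rule: dec_induct)
        case (step i)
        have "k * (m - i) \<le> Suc i * (m - k)"
          using step by (intro mult_le_mono) auto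
        moreover have "i < m" using step by simp
        ultimately have "t (Suc i) * (Suc i * (m - k)) \<le> t i * (Suc i * (m - k))"
          unfolding ratio[OF \<open>i < m\<close>] by (intro mult_le_mono2) (simp only: mult.commute)
        then have "t (Suc i) \<le> t i"
          using k by simp
        with step show ?case
          by simp
      qed simp
    qed
  qed
  then show ?thesis by (simp add: t_def)
qed

text \<open>The expansion of \<open>m ^ m\<close> has \<open>m + 1\<close> terms, none larger than
  the one at \<open>k\<close>.\<close>

lemma binomial_mode_ge:
  fixes m k :: nat
  assumes "k \<le> m"
  shows "m ^ m \<le> (m + 1) * ((m choose k) * k ^ k * (m - k) ^ (m - k))"
proof -
  have "m ^ m = (k + (m - k)) ^ m" using assms by simp
  also have "\<dots> = (\<Sum>j\<le>m. (m choose j) * k ^ j * (m - k) ^ (m - j))"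
    by (subst binomial) simp
  also have "\<dots> \<le> (\<Sum>j\<le>m. (m choose k) * k ^ k * (m - k) ^ (m - k))"
    using assms by (intro sum_mono binomial_term_le_mode) auto
  finally show ?thesis by simp
qed

text \<open>Here \<open>k\<close> is \<open>p * N\<close> rounded down and \<open>m\<close> only
  bounds \<open>N\<close> from above. The polynomial factor absorbs both the rounding and the number
  of terms in the binomial expansion.\<close>

lemma powr_entropy_le_binomial:
  fixes p N :: real and m k :: nat
  assumes p: "0 < p" "p \<le> 1" and N: "0 < N" "N \<le> real m"
    and k: "real k \<le> p * N" "p * N < real k + 1"
  shows "2 powr (binary_entropy p * N) \<le> 3 * (real m + 1)^2 * real (m choose k)"
proof -
  have m: "m > 0" using N by (cases m) auto
  have pN: "p * N \<le> N" using p N by simp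
  then have km: "k \<le> m" using N k by linarith
  have "(1 - p) * N \<ge> 0" using p N by simp
  consider "k = m" | "k = 0" | "0 < k" "k < m" using km by linarith
  then show ?thesis
  proof cases
    case 1
    \<comment> \<open>The chain \<open>k \<le> p * N \<le> N \<le> m = k\<close> collapses, so the
      entropy is 0.\<close>
    with k pN N have "p * N = 1 * N" by linarith
    then have "p = 1" using N by simp
    moreover have "1 \<le> 3 * (real m + 1)\<^sup>2" by (simp add: power2_eq_square algebra_simps)
    ultimately show ?thesis using 1 by simp
  next
    case 2
    \<comment> \<open>The frequency \<open>k / m\<close> would be 0, which is not admissible for
      \<open>q\<close>. With this choice \<open>p * N < 1\<close> bounds the first factor by
      \<open>m + 1\<close>, and the second is at most
      \<open>(1 + 1 / m) ^ m \<le> exp 1 \<le> 3\<close>: the source of the constant 3.\<close>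
    define q where "q = 1 / (real m + 1)"
    have q: "0 < q" "q < 1" using m by (auto simp: q_def)
    have "q powr (- (p * N)) = (real m + 1) powr (p * N)"
      by (simp add: q_def powr_divide powr_minus_divide)
    also have "\<dots> \<le> (real m + 1) powr 1"
      using 2 k by (intro powr_mono) auto
    finally have 1: "q powr (- (p * N)) \<le> real m + 1" by simp
    have "ln (1 - q) = - ln (1 + 1 / real m)"
    proof -
      have "1 - q = inverse (1 + 1 / real m)"
        using m by (simp add: q_def field_simps)
      then show ?thesis using m by (simp only: ln_inverse)
    qed
    then have "(1 - q) powr (- ((1 - p) * N)) = exp ((1 - p) * N * ln (1 + 1 / real m))"
      using q by (simp add: powr_def)
    also have "\<dots> \<le> exp ((1 - p) * N * (1 / real m))"
      using \<open>(1 - p) * N \<ge> 0\<close> by (simp add: mult_left_mono ln_add_one_self_le_self del: times_divide_eq_right)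
    also have "\<dots> \<le> exp 1"
    proof -
      have "(1 - p) * N \<le> real m" using p N mult_left_le_one_le[of N "1 - p"] by linarith
      then show ?thesis using m by (simp add: field_simps)
    qed
    also have "\<dots> \<le> 3" by (rule exp_le)
    finally have "q powr (- (p * N)) * (1 - q) powr (- ((1 - p) * N)) \<le> (real m + 1) * 3"
      using 1 by (intro mult_mono) auto
    then have "2 powr (binary_entropy p * N) \<le> (real m + 1) * 3"
      using powr_entropy_le[of p q N] p N q by linarith
    also have "\<dots> \<le> 3 * (real m + 1)^2"
      by (simp add: power2_eq_square algebra_simps)
    finally show ?thesis using 2 by simp
  next
    case 3
    \<comment> \<open>With this \<open>q\<close>, \<open>binomial_mode_ge\<close> divided by
      \<open>m ^ m\<close> speaks of \<open>q ^ k * (1 - q) ^ (m - k)\<close>.\<close>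
    define q where "q = real k / real m"
    have q: "0 < q" "q < 1" "1 - q = real (m - k) / real m"
      using 3 by (auto simp: q_def field_simps of_nat_diff)
    \<comment> \<open>The exponent is rounded up to \<open>k + 1\<close>; the surplus factor
      \<open>inverse q\<close> costs at most \<open>m\<close>.\<close>
    have "q powr (- (p * N)) \<le> q powr (- real (Suc k))"
      using k q by (intro powr_mono') auto
    also have "\<dots> = inverse (q ^ Suc k)"
      using q(1) by (simp only: powr_minus powr_realpow)
    finally have 1: "q powr (- (p * N)) \<le> inverse (q ^ Suc k)" .
    \<comment> \<open>No loss from rounding here: \<open>N \<le> m\<close> and
      \<open>k \<le> p * N\<close> give \<open>(1 - p) * N \<le> m - k\<close>.\<close>
    have "(1 - q) powr (- ((1 - p) * N)) \<le> (1 - q) powr (- real (m - k))"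
      using k q N km by (intro powr_mono') (auto simp: of_nat_diff algebra_simps)
    also have "\<dots> = inverse ((1 - q) ^ (m - k))"
      using q(2) by (simp only: powr_minus powr_realpow diff_gt_0_iff_gt)
    finally have 2: "(1 - q) powr (- ((1 - p) * N)) \<le> inverse ((1 - q) ^ (m - k))" .
    have "real m ^ m \<le> (real m + 1) * ((m choose k) * real k ^ k * real (m - k) ^ (m - k))"
      using of_nat_mono[OF binomial_mode_ge[OF km], where 'a = real] by (simp add: algebra_simps)
    moreover have "real m ^ m = real m ^ k * real m ^ (m - k)"
      using km by (simp flip: power_add)
    ultimately have "1 \<le> (real m + 1) * ((m choose k) * q ^ k * (1 - q) ^ (m - k))"
      using m unfolding q(3) unfolding q_def power_divide by (simp add: field_simps)
    then have 3: "inverse (q ^ k) * inverse ((1 - q) ^ (m - k)) \<le> (real m + 1) * (m choose k)"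
      using q(1,2) by (simp add: field_simps)
    have 4: "inverse q \<le> real m"
      using 3 \<open>0 < k\<close> m by (simp add: q_def field_simps)
    have "2 powr (binary_entropy p * N) \<le> inverse (q ^ Suc k) * inverse ((1 - q) ^ (m - k))"
      using powr_entropy_le[of p q N] p N q(1,2) mult_mono[OF 1 2] by simp
    also have "\<dots> = inverse q * (inverse (q ^ k) * inverse ((1 - q) ^ (m - k)))"
      by simp
    also have "\<dots> \<le> real m * ((real m + 1) * (m choose k))"
      using q(1,2) by (intro mult_mono[OF 4 3]) auto
    also have "\<dots> \<le> 3 * (real m + 1)^2 * (m choose k)"
      unfolding mult.assoc[symmetric]
      by (intro mult_right_mono) (auto simp: power2_eq_square algebra_simps)
    finally show ?thesis .
  qed
qed

section \<open>Flipping variables\<close>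

definition load :: "maxcsp \<Rightarrow> nat \<Rightarrow> real" where
  "load f j = (\<Sum>C\<leftarrow>constraints f. if j \<in> vars C then weight C else 0)"

definition flip :: "nat set \<Rightarrow> (nat \<Rightarrow> bool) \<Rightarrow> nat \<Rightarrow> bool" where
  "flip T z = (\<lambda>j. if j \<in> T then \<not> z j else z j)"

lemma sum_sum_list_swap:
  fixes g :: "'a \<Rightarrow> 'b \<Rightarrow> real"
  shows "(\<Sum>j\<in>T. \<Sum>C\<leftarrow>xs. g j C) = (\<Sum>C\<leftarrow>xs. \<Sum>j\<in>T. g j C)"
  by (induction xs) (simp_all add: sum.distrib)

lemma load_nonneg:
  assumes "maxcsp_instance f"
  shows "0 \<le> load f j"
  unfolding load_def
proof (rule sum_list_nonneg)
  fix x assume "x \<in> set (map (\<lambda>C. if j \<in> vars C then weight C else 0) (constraints f))"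
  with assms show "0 \<le> x"
    by (fastforce simp: maxcsp_instance_def)
qed

text \<open>Double counting: each constraint contributes its weight once for every variable it
  contains.\<close>

lemma sum_load:
  assumes "maxcsp_instance f"
  shows "(\<Sum>j\<in>{1..num_vars f}. load f j) = weighted_length f"
proof -
  have "(\<Sum>j\<in>{1..num_vars f}. if j \<in> vars C then weight C else 0) = real (card (vars C)) * weight C"
    if "C \<in> set (constraints f)" for C
  proof -
    have "{1..num_vars f} \<inter> vars C = vars C"
      using that assms by (auto simp: maxcsp_instance_def)
    then show ?thesis
      by (simp flip: sum.inter_restrict)
  qed
  then show ?thesis
    unfolding load_def weighted_length_def sum_sum_list_swap
    by (intro arg_cong[of _ _ sum_list] map_cong) auto
qed

text \<open>A constraint whose variables avoid \<open>T\<close> sees the same restricted assignment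
  and keeps its status. Any other constraint has a variable in \<open>T\<close>, whose load already
  pays for its weight.\<close>

lemma sat_weight_flip_ge:
  assumes "maxcsp_instance f" "finite T"
  shows "sat_weight f z - (\<Sum>j\<in>T. load f j) \<le> sat_weight f (flip T z)"
proof -
  have *: "sat_weight f z = (\<Sum>C\<leftarrow>constraints f. if satisfied z C then weight C else 0)" for z
    by (simp add: sat_weight_def sum_list_map_filter')
  have "(if satisfied z C then weight C else 0)
      \<le> (\<Sum>j\<in>T. if j \<in> vars C then weight C else 0)
        + (if satisfied (flip T z) C then weight C else 0)"
    if "C \<in> set (constraints f)" for C
  proof -
    have w: "0 < weight C" using that assms by (auto simp: maxcsp_instance_def)
    show ?thesis
    proof (cases "T \<inter> vars C = {}")
      case True
      then have "restrict (flip T z) (vars C) = restrict z (vars C)"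
        by (auto simp: flip_def restrict_def)
      then show ?thesis using w by (auto simp: satisfied_def intro!: sum_nonneg)
    next
      case False
      then obtain j where j: "j \<in> T" "j \<in> vars C" by auto
      have "weight C \<le> (\<Sum>j\<in>T. if j \<in> vars C then weight C else 0)"
        using member_le_sum[of j T "\<lambda>j. if j \<in> vars C then weight C else 0"] j w assms(2) by auto
      then show ?thesis using w by auto
    qed
  qed
  then have "sat_weight f z \<le> (\<Sum>j\<in>T. load f j) + sat_weight f (flip T z)"
    unfolding * load_def sum_sum_list_swap sum_list_addf[symmetric]
    by (intro sum_list_mono) auto
  then show ?thesis by simp
qed

lemma finite_assignments: "finite (assignments f)"
  by (auto simp: assignments_def intro!: finite_PiE)

lemma opt_weight_attained:
  obtains z where "z \<in> assignments f" "sat_weight f z = opt_weight f"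
proof -
  have "assignments f \<noteq> {}" by (simp add: assignments_def PiE_eq_empty_iff)
  then have "opt_weight f \<in> sat_weight f ` assignments f"
    unfolding opt_weight_def using finite_assignments by (intro Max_in) auto
  then show ?thesis using that by auto
qed

text \<open>Each \<open>k\<close>-subset of \<open>A\<close>, flipped in one fixed optimal
  assignment, loses at most \<open>k * b\<close>, and different subsets give different
  assignments.\<close>

lemma num_approx_ge:
  assumes f: "maxcsp_instance f" and A: "A \<subseteq> {1..num_vars f}"
    and load: "\<And>j. j \<in> A \<Longrightarrow> load f j \<le> b" and k: "real k * b \<le> \<epsilon> * total_weight f"
  shows "card A choose k \<le> num_approx f \<epsilon>"
proof -
  obtain z where z: "z \<in> assignments f" "sat_weight f z = opt_weight f"
    by (rule opt_weight_attained)
  have finA: "finite A" using A finite_subset by blast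
  have inj: "inj (\<lambda>T. flip T z)"
  proof (rule injI)
    fix T U assume "flip T z = flip U z"
    then have "flip T z j = flip U z j" for j by simp
    then show "T = U" unfolding flip_def by (metis (mono_tags) subsetI subset_antisym)
  qed
  have "(\<lambda>T. flip T z) ` {T. T \<subseteq> A \<and> card T = k}
      \<subseteq> {z \<in> assignments f. sat_weight f z \<ge> opt_weight f - \<epsilon> * total_weight f}"
  proof (intro subsetI, elim imageE CollectE conjE, intro CollectI conjI)
    fix y T assume y: "y = flip T z" and T: "T \<subseteq> A" "card T = k"
    show "y \<in> assignments f"
      using z T A by (auto simp: y assignments_def flip_def PiE_def extensional_def)
    have "(\<Sum>j\<in>T. load f j) \<le> real (card T) * b"
      using T load by (intro sum_bounded_above) auto
    with k have "(\<Sum>j\<in>T. load f j) \<le> \<epsilon> * total_weight f" by (simp add: T)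
    with sat_weight_flip_ge[OF f, of T z] T finA z
    show "sat_weight f y \<ge> opt_weight f - \<epsilon> * total_weight f"
      unfolding y using finite_subset by fastforce
  qed
  then have "card {T. T \<subseteq> A \<and> card T = k} \<le> num_approx f \<epsilon>"
    unfolding num_approx_def using finite_assignments
    by (subst card_image[OF inj_on_subset[OF inj], symmetric]) (auto intro!: card_mono)
  then show ?thesis using n_subsets[OF finA] by simp
qed

section \<open>Variables of low load and the bound for a fixed \<delta>\<close>

lemma total_weight_pos:
  assumes "maxcsp_instance f"
  shows "0 < total_weight f"
proof -
  have "constraints f \<noteq> []" "\<forall>C \<in> set (constraints f). weight C > 0"
    using assms by (simp_all add: maxcsp_instance_def)
  then have "0 < sum_list (map weight (constraints f))"
    by (induction rule: list_nonempty_induct) (simp_all add: add_pos_pos)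
  then show ?thesis by (simp add: total_weight_def)
qed

lemma total_weight_le_weighted_length:
  assumes "maxcsp_instance f"
  shows "total_weight f \<le> weighted_length f"
  unfolding total_weight_def weighted_length_def
proof (rule sum_list_mono)
  fix C assume "C \<in> set (constraints f)"
  then have C: "vars C \<subseteq> {1..num_vars f}" "vars C \<noteq> {}" "weight C > 0"
    using assms by (auto simp: maxcsp_instance_def)
  then have "card (vars C) > 0"
    by (meson card_gt_0_iff finite_atLeastAtMost finite_subset)
  then show "weight C \<le> real (card (vars C)) * weight C"
    using C by simp
qed

text \<open>Markov's inequality: the variables in \<open>B\<close> exceed \<delta> times the average
  load \<open>weighted_length f / n\<close>, so there are at most \<open>n / \<delta>\<close> of
  them.\<close>

lemma card_low_load_ge:
  fixes \<delta> :: real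
  assumes f: "maxcsp_instance f" and \<delta>: "0 < \<delta>"
  defines "n \<equiv> real (num_vars f)"
  shows "n - n / \<delta> \<le> card {j \<in> {1..num_vars f}. load f j \<le> \<delta> * weighted_length f / n}"
proof -
  define b where "b = \<delta> * weighted_length f / n"
  define A where "A = {j \<in> {1..num_vars f}. load f j \<le> b}"
  define B where "B = {1..num_vars f} - A"
  have n: "n > 0" using f by (simp add: n_def maxcsp_instance_def)
  have l: "weighted_length f > 0"
    using total_weight_pos[OF f] total_weight_le_weighted_length[OF f] by linarith
  have "real (card B) * b \<le> (\<Sum>j\<in>B. load f j)"
    by (intro sum_bounded_below) (auto simp: A_def B_def)
  also have "\<dots> \<le> (\<Sum>j\<in>{1..num_vars f}. load f j)"
    using load_nonneg[OF f] by (intro sum_mono2) (auto simp: B_def)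
  also have "\<dots> = weighted_length f" by (rule sum_load[OF f])
  finally have "real (card B) \<le> n / \<delta>"
    using n l \<delta> by (simp add: b_def field_simps)
  moreover have "real (card B) = n - real (card A)"
  proof -
    have "A \<subseteq> {1..num_vars f}" by (auto simp: A_def)
    then have "card B = num_vars f - card A" "card A \<le> num_vars f"
      using card_mono[of "{1..num_vars f}" A] by (auto simp: B_def card_Diff_subset finite_subset)
    then show ?thesis by (simp add: n_def of_nat_diff)
  qed
  ultimately show ?thesis by (simp add: A_def b_def)
qed

lemma num_approx_entropy_bound:
  fixes \<epsilon> \<delta> :: real
  assumes f: "maxcsp_instance f" and \<epsilon>: "0 < \<epsilon>"
    and \<delta>: "\<delta> \<ge> 1 + \<epsilon> * total_weight f / weighted_length f"
  defines "n \<equiv> real (num_vars f)"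
  shows "2 powr (binary_entropy (\<epsilon> * total_weight f / ((\<delta> - 1) * weighted_length f))
             * ((\<delta> - 1) / \<delta>) * n) \<le> 3 * (n + 1)^2 * real (num_approx f \<epsilon>)"
proof -
  define w where "w = total_weight f"
  define l where "l = weighted_length f"
  have w: "w > 0" "l > 0"
    using total_weight_pos[OF f] total_weight_le_weighted_length[OF f]
    by (auto simp: w_def l_def)
  have n: "n \<ge> 1" using f by (simp add: n_def maxcsp_instance_def)
  \<comment> \<open>\<open>N\<close> is the guaranteed number of low-load variables, and
    \<open>p * N\<close> is the budget \<open>\<epsilon> * w\<close> divided by the load bound
    \<open>\<delta> * l / n\<close>. So \<open>p\<close> is the fraction of them that may be
    flipped; the lower bound on \<delta> says exactly that \<open>p \<le> 1\<close>.\<close>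
  define p where "p = \<epsilon> * w / ((\<delta> - 1) * l)"
  define N where "N = (\<delta> - 1) / \<delta> * n"
  define A where "A = {j \<in> {1..num_vars f}. load f j \<le> \<delta> * l / n}"
  define k where "k = nat \<lfloor>p * N\<rfloor>"
  have "\<epsilon> * w / l > 0" using w \<epsilon> by simp
  with \<delta> have \<delta>1: "\<delta> > 1" "\<epsilon> * w / l \<le> \<delta> - 1" by (auto simp: w_def l_def)
  have p: "0 < p" "p \<le> 1"
    using \<delta>1 w \<epsilon> by (auto simp: p_def field_simps)
  have N: "0 < N" using \<delta>1 n by (simp add: N_def)
  have "N = n - n / \<delta>" using \<delta>1 by (simp add: N_def field_simps)
  with card_low_load_ge[OF f, of \<delta>] \<delta>1 have NA: "N \<le> card A"
    by (simp add: A_def n_def l_def)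
  have k: "real k \<le> p * N" "p * N < real k + 1"
    using p N by (auto simp: k_def)
  have pN: "p * N = \<epsilon> * w * n / (\<delta> * l)"
    using \<delta>1 by (simp add: p_def N_def mult_ac)
  have "real k * (\<delta> * l / n) \<le> \<epsilon> * w * n / (\<delta> * l) * (\<delta> * l / n)"
    using k pN \<delta>1 w n by (intro mult_right_mono) auto
  also have "\<dots> = \<epsilon> * w" using \<delta>1 w n by simp
  finally have "card A choose k \<le> num_approx f \<epsilon>"
    by (intro num_approx_ge[OF f, where b = "\<delta> * l / n"]) (auto simp: A_def w_def)
  moreover have "card A \<le> num_vars f"
    using card_mono[of "{1..num_vars f}" A] by (simp add: A_def subset_eq)
  moreover have "2 powr (binary_entropy p * N) \<le> 3 * (real (card A) + 1)^2 * real (card A choose k)"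
    using p N NA k by (rule powr_entropy_le_binomial)
  ultimately have "2 powr (binary_entropy p * N) \<le> 3 * (n + 1)^2 * real (num_approx f \<epsilon>)"
    by (elim order.trans) (auto intro!: mult_mono power_mono simp: n_def)
  then show ?thesis by (simp add: p_def N_def w_def l_def mult.assoc)
qed

section \<open>Attainment of the maximum and the final bound\<close>

text \<open>Under \<open>p = c / (\<delta> - 1)\<close> the unbounded range of \<delta> becomes the
  interval from 0 (excluded) to 1, with \<delta> tending to infinity as \<open>p\<close> tends to 0.
  Adding \<open>p = 0\<close> gives a compact interval on which \<open>G\<close> is
  continuous.\<close>

lemma entropy_exponent_max:
  fixes c :: real
  assumes c: "0 < c"
  obtains \<delta> where "\<delta> \<ge> 1 + c"
    "\<And>\<delta>'. \<delta>' \<ge> 1 + c \<Longrightarrow>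
       binary_entropy (c / (\<delta>' - 1)) * ((\<delta>' - 1) / \<delta>') \<le> binary_entropy (c / (\<delta> - 1)) * ((\<delta> - 1) / \<delta>)"
proof -
  define G where "G p = binary_entropy p * (c / (p + c))" for p
  have "continuous_on {0..1} G"
    unfolding G_def using c by (intro continuous_intros continuous_on_binary_entropy) auto
  then obtain p where p: "p \<in> {0..1}" "\<And>q. q \<in> {0..1} \<Longrightarrow> G q \<le> G p"
    using continuous_attains_sup[of "{0..1::real}" G] by auto
  \<comment> \<open>The added point \<open>p = 0\<close> corresponds to no \<delta>. It is not the
    maximizer, since \<open>G\<close> vanishes there and is positive at \<open>1/2\<close>.\<close>
  have "0 < G (1/2)" using c by (simp add: G_def binary_entropy_half)
  also have "\<dots> \<le> G p" by (rule p) auto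
  finally have "p \<noteq> 0" by (auto simp: G_def)
  with p have p0: "0 < p" "p \<le> 1" by auto
  have eq: "binary_entropy (c / (\<delta> - 1)) * ((\<delta> - 1) / \<delta>) = G (c / (\<delta> - 1))"
    if "\<delta> \<ge> 1 + c" for \<delta>
    using that c by (simp add: G_def field_simps)
  show ?thesis
  proof (rule that[of "1 + c / p"])
    show 1: "1 + c / p \<ge> 1 + c" using p0 c by (simp add: field_simps)
    fix \<delta>' assume \<delta>': "\<delta>' \<ge> 1 + c"
    have "G (c / (\<delta>' - 1)) \<le> G p" using \<delta>' c by (intro p) auto
    then show "binary_entropy (c / (\<delta>' - 1)) * ((\<delta>' - 1) / \<delta>')
        \<le> binary_entropy (c / (1 + c / p - 1)) * ((1 + c / p - 1) / (1 + c / p))"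
      unfolding eq[OF \<delta>'] eq[OF 1] using c p0 by simp
  qed
qed

theorem theorem2:
  "\<exists>p :: real poly. (\<forall>n::nat. n \<ge> 1 \<longrightarrow> poly p (real n) > 0) \<and>
     (\<forall>(f :: maxcsp) (\<epsilon> :: real). maxcsp_instance f \<longrightarrow> 0 < \<epsilon> \<longrightarrow> \<epsilon> \<le> 1 \<longrightarrow>
        (let n = num_vars f; w = total_weight f; l = weighted_length f;
             S = {2 powr (binary_entropy (\<epsilon> * w / ((\<delta> - 1) * l)) * ((\<delta> - 1) / \<delta>) * real n)
                   | \<delta> :: real. \<delta> \<ge> 1 + \<epsilon> * w / l}
         in \<exists>M \<in> S. (\<forall>x \<in> S. x \<le> M) \<and> real (num_approx f \<epsilon>) \<ge> M / poly p (real n)))"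
\<comment> \<open>The coefficients are those of \<open>3 * (x + 1)^2\<close>, the factor lost in
  \<open>num_approx_entropy_bound\<close>.\<close>
proof (intro exI[of _ "[:3, 6, 3:]"] conjI allI impI)
  fix n :: nat
  show "poly [:3, 6, 3:] (real n) > 0"
    by (simp add: add_pos_nonneg)
next
  fix f :: maxcsp and \<epsilon> :: real
  assume f: "maxcsp_instance f" and \<epsilon>: "0 < \<epsilon>"
  define w where "w = total_weight f"
  define l where "l = weighted_length f"
  define E where
    "E \<delta> = 2 powr (binary_entropy (\<epsilon> * w / ((\<delta> - 1) * l)) * ((\<delta> - 1) / \<delta>) * real (num_vars f))"
    for \<delta>
  have "w > 0" "l > 0"
    using total_weight_pos[OF f] total_weight_le_weighted_length[OF f]
    by (auto simp: w_def l_def)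
  then have c: "0 < \<epsilon> * w / l" using \<epsilon> by simp
  have frac: "\<epsilon> * w / ((\<delta> - 1) * l) = \<epsilon> * w / l / (\<delta> - 1)" for \<delta>
    by (simp add: mult.commute)
  obtain \<delta> where \<delta>: "\<delta> \<ge> 1 + \<epsilon> * w / l" "\<And>\<delta>'. \<delta>' \<ge> 1 + \<epsilon> * w / l \<Longrightarrow> E \<delta>' \<le> E \<delta>"
  proof (rule entropy_exponent_max[OF c])
    fix \<delta>
    assume 1: "\<delta> \<ge> 1 + \<epsilon> * w / l"
      and 2: "\<And>\<delta>'. \<delta>' \<ge> 1 + \<epsilon> * w / l \<Longrightarrow>
        binary_entropy (\<epsilon> * w / l / (\<delta>' - 1)) * ((\<delta>' - 1) / \<delta>')
        \<le> binary_entropy (\<epsilon> * w / l / (\<delta> - 1)) * ((\<delta> - 1) / \<delta>)"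
    \<comment> \<open>Scaling by the number of variables and taking \<open>2 powr\<close> are
      monotone, so the maximizer of the exponent also maximizes \<open>E\<close>.\<close>
    have "E \<delta>' \<le> E \<delta>" if "\<delta>' \<ge> 1 + \<epsilon> * w / l" for \<delta>'
      unfolding E_def frac by (intro powr_mono mult_right_mono 2 that) auto
    with 1 show thesis by (rule that)
  qed
  have poly: "poly [:3, 6, 3:] x = 3 * (x + 1)^2" for x :: real
    by (simp add: power2_eq_square algebra_simps)
  have "E \<delta> \<le> 3 * (real (num_vars f) + 1)^2 * real (num_approx f \<epsilon>)"
    using num_approx_entropy_bound[OF f \<epsilon>, of \<delta>] \<delta>(1) by (simp add: E_def w_def l_def)
  then have "E \<delta> / poly [:3, 6, 3:] (real (num_vars f)) \<le> real (num_approx f \<epsilon>)"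
    unfolding poly by (simp add: divide_le_eq mult.commute add_pos_nonneg)
  with \<delta> show "let n = num_vars f; w = total_weight f; l = weighted_length f;
             S = {2 powr (binary_entropy (\<epsilon> * w / ((\<delta> - 1) * l)) * ((\<delta> - 1) / \<delta>) * real n)
                   | \<delta> :: real. \<delta> \<ge> 1 + \<epsilon> * w / l}
         in \<exists>M \<in> S. (\<forall>x \<in> S. x \<le> M) \<and> real (num_approx f \<epsilon>) \<ge> M / poly [:3, 6, 3:] (real n)"
    unfolding Let_def w_def[symmetric] l_def[symmetric] E_def[symmetric]
    by (intro bexI[of _ "E \<delta>"]) auto
qed

end
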